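(* Let $\hbar>0$, $\nu>\hbar/2$, $u=(2\nu/\hbar)^2>1$, and let $\alpha,\beta,\gamma>0$. Let $G_0^{(\alpha,\beta)}$ and $G_2^{(\alpha,\beta)}$ be the minima of $$F_{\alpha,\beta,\gamma}(K)^2=\tfrac14\left[\alpha\operatorname{Tr}(A^{\mathsf T}A)+2\beta\operatorname{Tr}(B^{\mathsf T}B)+\gamma\operatorname{Tr}(D^{\mathsf T}D)\right]$$ over all $K\in\mathfrak{sp}(4,\mathbb R)$ with blocks $A,B,D$ that induce, at the canonical purification of $\nu\mathbb I_2$, the reduced tangent $\mathbb I_2$, respectively $Z$. Then $$G_0^{(\alpha,\beta)}=\frac{\beta}{\hbar^2(u-1)},\qquad G_2^{(\alpha,\beta)}=\frac{\alpha\beta}{\hbar^2\left[\alpha(u-1)+2\beta u\right]},$$ and therefore $$\frac{G_0^{(\alpha,\beta)}}{G_2^{(\alpha,\beta)}}=1+2\,\frac{\beta}{\alpha}\,\frac{u}{u-1}.$$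
   Context: Let $\Omega=\begin{pmatrix}0&1\\-1&0\end{pmatrix}$, $Z=\begin{pmatrix}1&0\\0&-1\end{pmatrix}$, $\kappa_\nu=\sqrt{\nu^2-\hbar^2/4}$. The canonical purification of the one-mode covariance $\nu\mathbb I_2$ has covariance $\Gamma_\nu=\begin{pmatrix}\nu\mathbb I_2&\kappa_\nu Z\\ \kappa_\nu Z&\nu\mathbb I_2\end{pmatrix}$. With symplectic form $\Omega\oplus\Omega$, every $K\in\mathfrak{sp}(4,\mathbb R)$ has the block form $$K=\begin{pmatrix}A&B\\ \Omega B^{\mathsf T}\Omega&D\end{pmatrix},\qquad A,D\in\mathfrak{sp}(2,\mathbb R)\ (\text{real traceless } 2\times2),\quad B\in\mathbb R^{2\times2}\text{ arbitrary}.$$ $K$ induces the reduced tangent $X$ (a real symmetric $2\times2$ matrix) if the upper-left (system) $2\times2$ block of $K\Gamma_\nu+\Gamma_\nu K^{\mathsf T}$ equals $X$, i.e. $X=\nu(A+A^{\mathsf T})+\kappa_\nu(BZ+ZB^{\mathsf T})$. *)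

theory Defs
  imports "HOL-Analysis.Analysis"
begin

text \<open>
  Two-mode matrices are indexed by the sum type \<open>2 + 2\<close>: the left summand is the
  system mode, the right one the ancilla mode, so that the \<open>2 \<times> 2\<close> blocks are read off
  along \<open>Inl\<close> and \<open>Inr\<close>.
\<close>

type_synonym mat2 = "real^2^2"
type_synonym mat4 = "real^(2 + 2)^(2 + 2)"

definition block_matrix :: "mat2 \<Rightarrow> mat2 \<Rightarrow> mat2 \<Rightarrow> mat2 \<Rightarrow> mat4" where
  "block_matrix A B C D = (\<chi> i j. case (i, j) of
       (Inl k, Inl l) \<Rightarrow> A $ k $ l
     | (Inl k, Inr l) \<Rightarrow> B $ k $ l
     | (Inr k, Inl l) \<Rightarrow> C $ k $ l
     | (Inr k, Inr l) \<Rightarrow> D $ k $ l)"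

definition block11 :: "mat4 \<Rightarrow> mat2" where
  "block11 K = (\<chi> i j. K $ Inl i $ Inl j)"

definition block12 :: "mat4 \<Rightarrow> mat2" where
  "block12 K = (\<chi> i j. K $ Inl i $ Inr j)"

definition block21 :: "mat4 \<Rightarrow> mat2" where
  "block21 K = (\<chi> i j. K $ Inr i $ Inl j)"

definition block22 :: "mat4 \<Rightarrow> mat2" where
  "block22 K = (\<chi> i j. K $ Inr i $ Inr j)"

definition Omega :: mat2 where
  "Omega = vector [vector [0, 1], vector [-1, 0]]"

definition Zmat :: mat2 where
  "Zmat = vector [vector [1, 0], vector [0, -1]]"

definition Omega4 :: mat4 where
  "Omega4 = block_matrix Omega 0 0 Omega"

definition sp4 :: "mat4 set" where
  "sp4 = {K. transpose K ** Omega4 + Omega4 ** K = 0}"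

definition kappa :: "real \<Rightarrow> real \<Rightarrow> real" where
  "kappa hbar \<nu> = sqrt (\<nu>\<^sup>2 - hbar\<^sup>2 / 4)"

definition purification_cov :: "real \<Rightarrow> real \<Rightarrow> mat4" where
  "purification_cov hbar \<nu> =
     block_matrix (\<nu> *\<^sub>R mat 1) (kappa hbar \<nu> *\<^sub>R Zmat)
                  (kappa hbar \<nu> *\<^sub>R Zmat) (\<nu> *\<^sub>R mat 1)"

definition reduced_tangent :: "real \<Rightarrow> real \<Rightarrow> mat4 \<Rightarrow> mat2" where
  "reduced_tangent hbar \<nu> K =
     block11 (K ** purification_cov hbar \<nu> + purification_cov hbar \<nu> ** transpose K)"

definition inducing :: "real \<Rightarrow> real \<Rightarrow> mat2 \<Rightarrow> mat4 set" where
  "inducing hbar \<nu> X = {K \<in> sp4. reduced_tangent hbar \<nu> K = X}"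

text \<open>The squared cost; the lower-left block is determined by \<open>B\<close> on \<open>sp4\<close>, whence the
  factor \<open>2\<close> in front of \<open>\<beta>\<close>.\<close>

definition F_sq :: "real \<Rightarrow> real \<Rightarrow> real \<Rightarrow> mat4 \<Rightarrow> real" where
  "F_sq \<alpha> \<beta> \<gamma> K = 1 / 4 *
     (\<alpha> * trace (transpose (block11 K) ** block11 K)
      + 2 * \<beta> * trace (transpose (block12 K) ** block12 K)
      + \<gamma> * trace (transpose (block22 K) ** block22 K))"

text \<open>\<open>m\<close> is the attained minimum of \<open>f\<close> on \<open>S\<close> (not merely the infimum).\<close>

definition is_minimum :: "('a \<Rightarrow> real) \<Rightarrow> 'a set \<Rightarrow> real \<Rightarrow> bool" where
  "is_minimum f S m \<longleftrightarrow> (\<exists>K\<in>S. f K = m) \<and> (\<forall>K\<in>S. m \<le> f K)"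

definition min_cost :: "real \<Rightarrow> real \<Rightarrow> real \<Rightarrow> real \<Rightarrow> real \<Rightarrow> mat2 \<Rightarrow> real" where
  "min_cost hbar \<nu> \<alpha> \<beta> \<gamma> X = (THE m. is_minimum (F_sq \<alpha> \<beta> \<gamma>) (inducing hbar \<nu> X) m)"

text \<open>Consistency with the block descriptions of the Lie algebra and of the induced tangent.\<close>

lemma sum_UNIV_Plus22: "(\<Sum>i\<in>(UNIV::(2+2) set). f i) =
    f (Inl 1) + f (Inl 2) + f (Inr 1) + (f (Inr 2) :: real)"
proof -
  have "sum f (UNIV::(2+2) set) = sum f ((UNIV::2 set) <+> (UNIV::2 set))"
    by (simp only: UNIV_Plus_UNIV)
  also have "\<dots> = (\<Sum>i\<in>UNIV. f (Inl i)) + (\<Sum>i\<in>UNIV. f (Inr i))"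
    by (subst sum.Plus) (simp_all add: o_def)
  finally show ?thesis
    by (simp add: sum_2)
qed

lemma all_Plus22: "(\<forall>i::2+2. P i) \<longleftrightarrow> P (Inl 1) \<and> P (Inl 2) \<and> P (Inr 1) \<and> P (Inr 2)"
  by (simp add: split_sum_all forall_2)

lemma sp4_iff_blocks:
  "K \<in> sp4 \<longleftrightarrow> trace (block11 K) = 0 \<and> trace (block22 K) = 0
     \<and> block21 K = Omega ** transpose (block12 K) ** Omega"
  unfolding sp4_def Omega4_def block_matrix_def block11_def block12_def block21_def
    block22_def Omega_def
  by (auto simp: vec_eq_iff all_Plus22 forall_2 matrix_matrix_mult_def transpose_def
      sum_UNIV_Plus22 sum_2 trace_def)

lemma reduced_tangent_blocks:
  "reduced_tangent hbar \<nu> K =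
     \<nu> *\<^sub>R (block11 K + transpose (block11 K))
     + kappa hbar \<nu> *\<^sub>R (block12 K ** Zmat + Zmat ** transpose (block12 K))"
  unfolding reduced_tangent_def purification_cov_def block_matrix_def block11_def block12_def
    Zmat_def
  by (auto simp: vec_eq_iff forall_2 matrix_matrix_mult_def transpose_def
      sum_UNIV_Plus22 sum_2 mat_def algebra_simps)

end

theory Submission
  imports Defs
begin

text \<open>
  In terms of the matrix entries the two diagonal tangent conditions read
  \<open>\<nu> a + \<kappa> p = X\<^sub>1\<^sub>1/2\<close> and \<open>- \<nu> a - \<kappa> s = X\<^sub>2\<^sub>2/2\<close>, where \<open>a = A\<^sub>1\<^sub>1 = - A\<^sub>2\<^sub>2\<close>,
  \<open>p = B\<^sub>1\<^sub>1\<close> and \<open>s = B\<^sub>2\<^sub>2\<close>; all other entries only add to the cost. For the identity they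
  force \<open>\<kappa> (p - s) = 1\<close>, so the optimum is \<open>a = 0\<close>, \<open>p = - s\<close>. For \<open>Z\<close> they force
  \<open>p = s\<close>, and \<open>2 \<alpha> a\<^sup>2 + 4 \<beta> p\<^sup>2\<close> is minimised on the line \<open>\<nu> a + \<kappa> p = 1/2\<close> by Cauchy--Schwarz.
\<close>

lemma is_minimum_unique:
  assumes "is_minimum f S m" and "is_minimum f S m'"
  shows "m = m'"
  using assms unfolding is_minimum_def by (metis order_antisym)

text \<open>\<open>min_cost\<close> is a definite description, so it has a usable value only once a
  minimum is exhibited. Uniqueness is antisymmetry: each of two attained minima bounds the other
  from below.\<close>

lemma min_cost_eqI:
  assumes "is_minimum (F_sq \<alpha> \<beta> \<gamma>) (inducing hbar \<nu> X) m"
  shows "min_cost hbar \<nu> \<alpha> \<beta> \<gamma> X = m"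
  unfolding min_cost_def using assms by (blast intro: the_equality is_minimum_unique)

lemma block_block_matrix [simp]:
  "block11 (block_matrix A B C D) = A" "block12 (block_matrix A B C D) = B"
  "block21 (block_matrix A B C D) = C" "block22 (block_matrix A B C D) = D"
  by (simp_all add: block_matrix_def block11_def block12_def block21_def block22_def vec_eq_iff)

lemma trace_transpose_mult_self:
  fixes M :: mat2
  shows "trace (transpose M ** M) = (M$1$1)\<^sup>2 + (M$1$2)\<^sup>2 + (M$2$1)\<^sup>2 + (M$2$2)\<^sup>2"
  by (simp add: trace_def transpose_def matrix_matrix_mult_def sum_2 power2_eq_square)

lemma reduced_tangent_diagonal:
  "reduced_tangent hbar \<nu> K $ 1 $ 1 =
     2 * (\<nu> * block11 K $ 1 $ 1 + kappa hbar \<nu> * block12 K $ 1 $ 1)"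
  "reduced_tangent hbar \<nu> K $ 2 $ 2 =
     2 * (\<nu> * block11 K $ 2 $ 2 - kappa hbar \<nu> * block12 K $ 2 $ 2)"
  by (simp_all add: reduced_tangent_blocks matrix_matrix_mult_def transpose_def sum_2 Zmat_def)

lemma sp4_block11_22:
  assumes "K \<in> sp4"
  shows "block11 K $ 2 $ 2 = - block11 K $ 1 $ 1"
  using assms by (simp add: sp4_iff_blocks trace_def sum_2)

text \<open>The discarded terms, namely the off-diagonal squares of A and B and all of D, have
  nonnegative weights. Tracelessness of A merges its two diagonal squares into one, whence the
  factor 2 at \<alpha>.\<close>

lemma F_sq_ge_diagonal:
  assumes "0 \<le> \<alpha>" "0 \<le> \<beta>" "0 \<le> \<gamma>" "K \<in> sp4"
  shows "1 / 4 * (2 * \<alpha> * (block11 K $ 1 $ 1)\<^sup>2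
           + 2 * \<beta> * ((block12 K $ 1 $ 1)\<^sup>2 + (block12 K $ 2 $ 2)\<^sup>2)) \<le> F_sq \<alpha> \<beta> \<gamma> K"
proof -
  let ?A = "block11 K" and ?B = "block12 K" and ?D = "block22 K"
  have "0 \<le> \<alpha> * ((?A$1$2)\<^sup>2 + (?A$2$1)\<^sup>2)" "0 \<le> 2 * \<beta> * ((?B$1$2)\<^sup>2 + (?B$2$1)\<^sup>2)"
    "0 \<le> \<gamma> * ((?D$1$1)\<^sup>2 + (?D$1$2)\<^sup>2 + (?D$2$1)\<^sup>2 + (?D$2$2)\<^sup>2)"
    using assms by simp_all
  then show ?thesis
    unfolding F_sq_def trace_transpose_mult_self sp4_block11_22 [OF assms(4)]
    by (simp add: algebra_simps)
qed

text \<open>The family of candidate minimisers. Every entry discarded in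
  \<open>F_sq_ge_diagonal\<close> is zero here, so that bound becomes an equality; the lower-left
  block is the one membership in \<open>sp4\<close> forces.\<close>

definition diag_generator :: "real \<Rightarrow> real \<Rightarrow> real \<Rightarrow> mat4" where
  "diag_generator a p s =
     (let B = vector [vector [p, 0], vector [0, s]]
      in block_matrix (vector [vector [a, 0], vector [0, - a]]) B
           (Omega ** transpose B ** Omega) 0)"

lemma diag_generator_sp4: "diag_generator a p s \<in> sp4"
  by (simp add: diag_generator_def Let_def sp4_iff_blocks trace_def sum_2)

lemma reduced_tangent_diag_generator:
  "reduced_tangent hbar \<nu> (diag_generator a p s) =
     vector [vector [2 * (\<nu> * a + kappa hbar \<nu> * p), 0],
             vector [0, - 2 * (\<nu> * a + kappa hbar \<nu> * s)]]"
  by (simp add: diag_generator_def Let_def reduced_tangent_blocks vec_eq_iff forall_2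
      matrix_matrix_mult_def transpose_def sum_2 Zmat_def algebra_simps)

lemma F_sq_diag_generator:
  "F_sq \<alpha> \<beta> \<gamma> (diag_generator a p s) = 1 / 4 * (2 * \<alpha> * a\<^sup>2 + 2 * \<beta> * (p\<^sup>2 + s\<^sup>2))"
proof -
  have "trace (0 :: mat2) = 0" by (simp add: trace_def)
  then show ?thesis
    by (simp add: diag_generator_def Let_def F_sq_def trace_transpose_mult_self)
qed

lemma is_minimum_identity_tangent:
  assumes "0 < kappa hbar \<nu>" "0 < \<alpha>" "0 < \<beta>" "0 < \<gamma>"
  shows "is_minimum (F_sq \<alpha> \<beta> \<gamma>) (inducing hbar \<nu> (mat 1)) (\<beta> / (4 * (kappa hbar \<nu>)\<^sup>2))"
  unfolding is_minimum_def
proof (intro conjI ballI)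
  let ?k = "kappa hbar \<nu>"
  \<comment> \<open>With \<open>a = 0\<close> the two tangent conditions become \<kappa> p = 1/2 and
    \<kappa> s = -1/2.\<close>
  let ?K = "diag_generator 0 (1 / (2 * ?k)) (- (1 / (2 * ?k)))"
  have "?K \<in> inducing hbar \<nu> (mat 1)"
    using assms by (simp add: inducing_def diag_generator_sp4 reduced_tangent_diag_generator
        vec_eq_iff forall_2 mat_def)
  moreover have "F_sq \<alpha> \<beta> \<gamma> ?K = \<beta> / (4 * ?k\<^sup>2)"
    using assms by (simp add: F_sq_diag_generator power_divide power_mult_distrib)
  ultimately show "\<exists>K\<in>inducing hbar \<nu> (mat 1). F_sq \<alpha> \<beta> \<gamma> K = \<beta> / (4 * ?k\<^sup>2)" by blast
next
  let ?k = "kappa hbar \<nu>"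
  fix K assume K: "K \<in> inducing hbar \<nu> (mat 1)"
  define a p s where "a = block11 K $ 1 $ 1" and "p = block12 K $ 1 $ 1" and "s = block12 K $ 2 $ 2"
  have sp: "K \<in> sp4" and X: "reduced_tangent hbar \<nu> K = mat 1"
    using K by (auto simp: inducing_def)
  have "2 * (\<nu> * a + ?k * p) = 1" "2 * (- \<nu> * a - ?k * s) = 1"
    using reduced_tangent_diagonal [of hbar \<nu> K] sp4_block11_22 [OF sp]
    by (simp_all add: X mat_def a_def p_def s_def)
  \<comment> \<open>Adding the two conditions eliminates \<open>a\<close>.\<close>
  then have "?k * (p - s) = 1" by (simp add: algebra_simps)
  then have "p - s = 1 / ?k" using assms by (simp add: field_simps)
  then have "\<beta> / (4 * ?k\<^sup>2) = 1 / 4 * (\<beta> * (p - s)\<^sup>2)" by (simp add: power_divide)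
  also have "\<dots> \<le> 1 / 4 * (2 * \<alpha> * a\<^sup>2 + 2 * \<beta> * (p\<^sup>2 + s\<^sup>2))"
  proof -
    \<comment> \<open>By the parallelogram identity 2 (p^2 + s^2) = (p - s)^2 + (p + s)^2, this is
      four times the gap between the two sides.\<close>
    have "0 \<le> 2 * \<alpha> * a\<^sup>2 + \<beta> * (p + s)\<^sup>2" using assms by simp
    then show ?thesis by (simp add: power2_sum power2_diff algebra_simps)
  qed
  also have "\<dots> \<le> F_sq \<alpha> \<beta> \<gamma> K"
    unfolding a_def p_def s_def using assms by (intro F_sq_ge_diagonal sp) simp_all
  finally show "\<beta> / (4 * ?k\<^sup>2) \<le> F_sq \<alpha> \<beta> \<gamma> K" .
qed

lemma weighted_sum_squares_on_line:
  fixes \<alpha> \<beta> \<nu> k a p :: real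
  assumes "0 < \<alpha>" "0 < \<beta>" "0 < k" and line: "\<nu> * a + k * p = 1 / 2"
  shows "\<alpha> * \<beta> / (4 * (2 * \<beta> * \<nu>\<^sup>2 + \<alpha> * k\<^sup>2))
    \<le> 1 / 4 * (2 * \<alpha> * a\<^sup>2 + 2 * \<beta> * (p\<^sup>2 + p\<^sup>2))"
proof -
  let ?N = "2 * \<beta> * \<nu>\<^sup>2 + \<alpha> * k\<^sup>2"
  have N: "0 < ?N" using assms by (intro add_nonneg_pos) simp_all
  \<comment> \<open>Lagrange's identity: Cauchy-Schwarz with its defect written as an explicit
    square. On the line the first summand equals \<alpha> \<beta>.\<close>
  have "(2 * \<alpha> * a\<^sup>2 + 4 * \<beta> * p\<^sup>2) * ?N
      = 4 * \<alpha> * \<beta> * (\<nu> * a + k * p)\<^sup>2 + 2 * (\<alpha> * k * a - 2 * \<beta> * \<nu> * p)\<^sup>2"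
    by algebra
  then have "\<alpha> * \<beta> \<le> (2 * \<alpha> * a\<^sup>2 + 4 * \<beta> * p\<^sup>2) * ?N"
    by (simp add: line power_divide)
  then have "\<alpha> * \<beta> / ?N \<le> 2 * \<alpha> * a\<^sup>2 + 4 * \<beta> * p\<^sup>2"
    using N by (simp only: pos_divide_le_eq)
  then have "1 / 4 * (\<alpha> * \<beta> / ?N) \<le> 1 / 4 * (2 * \<alpha> * a\<^sup>2 + 4 * \<beta> * p\<^sup>2)"
    by (rule mult_left_mono) simp
  moreover have "1 / 4 * (\<alpha> * \<beta> / ?N) = \<alpha> * \<beta> / (4 * ?N)"
    by (simp only: times_divide_times_eq mult_1)
  moreover have "2 * \<alpha> * a\<^sup>2 + 4 * \<beta> * p\<^sup>2 = 2 * \<alpha> * a\<^sup>2 + 2 * \<beta> * (p\<^sup>2 + p\<^sup>2)"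
    by simp
  ultimately show ?thesis by (simp only:)
qed

lemma is_minimum_Zmat_tangent:
  assumes "0 < kappa hbar \<nu>" "0 < \<alpha>" "0 < \<beta>" "0 < \<gamma>"
  shows "is_minimum (F_sq \<alpha> \<beta> \<gamma>) (inducing hbar \<nu> Zmat)
           (\<alpha> * \<beta> / (4 * (2 * \<beta> * \<nu>\<^sup>2 + \<alpha> * (kappa hbar \<nu>)\<^sup>2)))"
  unfolding is_minimum_def
proof (intro conjI ballI)
  let ?k = "kappa hbar \<nu>"
  \<comment> \<open>\<open>N\<close> is kept folded so that \<open>field_simps\<close> clears it as
    a single positive denominator; it is expanded only afterwards.\<close>
  define N where "N = 2 * \<beta> * \<nu>\<^sup>2 + \<alpha> * ?k\<^sup>2"
  have N: "0 < N" unfolding N_def using assms by (intro add_nonneg_pos) simp_all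
  \<comment> \<open>The equality case of Cauchy-Schwarz: the defect vanishes when \<alpha> \<kappa>
    a = 2 \<beta> \<nu> p, and the line condition fixes the scale.\<close>
  define a p where "a = \<beta> * \<nu> / N" and "p = \<alpha> * ?k / (2 * N)"
  let ?K = "diag_generator a p p"
  have "\<nu> * a + ?k * p = N / (2 * N)"
    unfolding a_def p_def using N by (simp add: field_simps) (simp add: N_def power2_eq_square)
  then have "\<nu> * a + ?k * p = 1 / 2" using N by simp
  then have "?K \<in> inducing hbar \<nu> Zmat"
    by (simp add: inducing_def diag_generator_sp4 reduced_tangent_diag_generator Zmat_def
        vec_eq_iff forall_2)
  moreover have "F_sq \<alpha> \<beta> \<gamma> ?K = \<alpha> * \<beta> / (4 * N)"
  proof -
    have "2 * \<alpha> * a\<^sup>2 + 2 * \<beta> * (p\<^sup>2 + p\<^sup>2) = \<alpha> * \<beta> * N / N\<^sup>2"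
      unfolding a_def p_def using N
      by (simp add: power_divide power_mult_distrib field_simps)
        (simp add: N_def algebra_simps power2_eq_square)
    then show ?thesis using N by (simp add: F_sq_diag_generator power2_eq_square)
  qed
  ultimately show "\<exists>K\<in>inducing hbar \<nu> Zmat.
      F_sq \<alpha> \<beta> \<gamma> K = \<alpha> * \<beta> / (4 * (2 * \<beta> * \<nu>\<^sup>2 + \<alpha> * ?k\<^sup>2))"
    unfolding N_def by blast
next
  let ?k = "kappa hbar \<nu>"
  fix K assume K: "K \<in> inducing hbar \<nu> Zmat"
  define a p s where "a = block11 K $ 1 $ 1" and "p = block12 K $ 1 $ 1" and "s = block12 K $ 2 $ 2"
  have sp: "K \<in> sp4" and X: "reduced_tangent hbar \<nu> K = Zmat"
    using K by (auto simp: inducing_def)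
  have line: "2 * (\<nu> * a + ?k * p) = 1" and line': "2 * (- (\<nu> * a) - ?k * s) = - 1"
    using reduced_tangent_diagonal [of hbar \<nu> K] sp4_block11_22 [OF sp]
    by (simp_all add: X Zmat_def a_def p_def s_def)
  \<comment> \<open>The sum of the two conditions is 2 \<kappa> (p - s) = 0, and \<kappa> can be
    cancelled because it is positive.\<close>
  have "?k * p = ?k * s" using line line' by algebra
  then have ps: "s = p" using assms by simp
  have "\<alpha> * \<beta> / (4 * (2 * \<beta> * \<nu>\<^sup>2 + \<alpha> * ?k\<^sup>2))
      \<le> 1 / 4 * (2 * \<alpha> * a\<^sup>2 + 2 * \<beta> * (p\<^sup>2 + s\<^sup>2))"
    unfolding ps using assms line by (intro weighted_sum_squares_on_line) simp_all
  also have "\<dots> \<le> F_sq \<alpha> \<beta> \<gamma> K"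
    unfolding a_def p_def s_def using assms by (intro F_sq_ge_diagonal sp) simp_all
  finally show "\<alpha> * \<beta> / (4 * (2 * \<beta> * \<nu>\<^sup>2 + \<alpha> * ?k\<^sup>2)) \<le> F_sq \<alpha> \<beta> \<gamma> K" .
qed

theorem mainTheorem7:
  fixes hbar \<nu> u \<alpha> \<beta> \<gamma> :: real
  assumes "hbar > 0" and "\<nu> > hbar / 2" and "u = (2 * \<nu> / hbar)\<^sup>2"
    and "\<alpha> > 0" and "\<beta> > 0" and "\<gamma> > 0"
    and "G0 = min_cost hbar \<nu> \<alpha> \<beta> \<gamma> (mat 1)"
    and "G2 = min_cost hbar \<nu> \<alpha> \<beta> \<gamma> Zmat"
  shows "is_minimum (F_sq \<alpha> \<beta> \<gamma>) (inducing hbar \<nu> (mat 1)) G0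
    \<and> is_minimum (F_sq \<alpha> \<beta> \<gamma>) (inducing hbar \<nu> Zmat) G2
    \<and> G0 = \<beta> / (hbar\<^sup>2 * (u - 1))
    \<and> G2 = \<alpha> * \<beta> / (hbar\<^sup>2 * (\<alpha> * (u - 1) + 2 * \<beta> * u))
    \<and> G0 / G2 = 1 + 2 * (\<beta> / \<alpha>) * (u / (u - 1))"
proof -
  let ?k = "kappa hbar \<nu>"
  have nu: "4 * \<nu>\<^sup>2 = hbar\<^sup>2 * u"
    using assms(1) by (simp add: assms(3) power_divide power_mult_distrib)
  \<comment> \<open>The strict bound on \<nu> makes the radicand of \<open>kappa\<close> positive,
    so that \<kappa> is nonzero and \<open>u\<close> exceeds 1.\<close>
  have "(hbar / 2)\<^sup>2 < \<nu>\<^sup>2"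
    using assms(1,2) by (intro power_strict_mono) simp_all
  then have pos: "0 < \<nu>\<^sup>2 - hbar\<^sup>2 / 4" by (simp add: power_divide)
  then have kpos: "0 < ?k" by (simp add: kappa_def)
  have kap: "4 * ?k\<^sup>2 = hbar\<^sup>2 * (u - 1)"
    using pos nu by (simp add: kappa_def algebra_simps)
  then have u: "0 < u - 1"
    using kpos assms(1) by (metis zero_less_mult_pos zero_less_power mult_pos_pos zero_less_numeral)
  have min0: "is_minimum (F_sq \<alpha> \<beta> \<gamma>) (inducing hbar \<nu> (mat 1)) (\<beta> / (hbar\<^sup>2 * (u - 1)))"
    using is_minimum_identity_tangent [OF kpos assms(4-6)] by (simp only: kap)
  \<comment> \<open>Distributing the 4 exposes 4 \<nu>^2 and 4 \<kappa>^2, which \<open>nu\<close>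
    and \<open>kap\<close> express through \<open>u\<close>.\<close>
  have "4 * (2 * \<beta> * \<nu>\<^sup>2 + \<alpha> * ?k\<^sup>2) = 2 * \<beta> * (4 * \<nu>\<^sup>2) + \<alpha> * (4 * ?k\<^sup>2)"
    by (simp add: algebra_simps)
  also have "\<dots> = hbar\<^sup>2 * (\<alpha> * (u - 1) + 2 * \<beta> * u)"
    unfolding nu kap by (simp add: algebra_simps)
  finally have min2: "is_minimum (F_sq \<alpha> \<beta> \<gamma>) (inducing hbar \<nu> Zmat)
      (\<alpha> * \<beta> / (hbar\<^sup>2 * (\<alpha> * (u - 1) + 2 * \<beta> * u)))"
    using is_minimum_Zmat_tangent [OF kpos assms(4-6)] by simp
  have G0: "G0 = \<beta> / (hbar\<^sup>2 * (u - 1))"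
    unfolding assms(7) by (rule min_cost_eqI [OF min0])
  have G2: "G2 = \<alpha> * \<beta> / (hbar\<^sup>2 * (\<alpha> * (u - 1) + 2 * \<beta> * u))"
    unfolding assms(8) by (rule min_cost_eqI [OF min2])
  \<comment> \<open>The common factor \<beta> / hbar^2 cancels.\<close>
  have "G0 / G2 = (\<alpha> * (u - 1) + 2 * \<beta> * u) / (\<alpha> * (u - 1))"
    unfolding G0 G2 using assms(1,5) by simp
  also have "\<dots> = 1 + 2 * (\<beta> / \<alpha>) * (u / (u - 1))"
    using assms(4) u by (simp add: add_divide_distrib)
  finally show ?thesis using min0 min2 G0 G2 by simp
qed

end
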